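(* Let $b\ge2$ and $N\ge1$. The matrices $U_N$ and $V_N$ satisfy \[ U_N^{b+1}=V_N^{b+1}=(-1)^{N(b+1)}I_{b^N}, \] where $I_{b^N}$ is the $b^N\times b^N$ identity matrix.
   Context: $\otimes$ is the Kronecker product. $M_1$ is the $b\times b$ lower-bidiagonal matrix with all diagonal entries $1$, all entries directly below the diagonal equal to $-1$, and all other entries $0$; $M_{N+1}=M_1\otimes M_N$. $S_1$ is the $b\times b$ lower-triangular matrix with all entries on and below the diagonal equal to $1$ and others $0$; $S_{N+1}=S_1\otimes S_N$. $T_N=M_N^t$ is the transpose of $M_N$, $U_N=S_NT_N$ and $V_N=T_NS_N$. *)

theory Defs
  imports "Jordan_Normal_Form.Matrix"
begin

definition kronecker_mat :: "'a :: times mat \<Rightarrow> 'a mat \<Rightarrow> 'a mat" where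
  "kronecker_mat A B =
     mat (dim_row A * dim_row B) (dim_col A * dim_col B)
       (\<lambda>(i, j). A $$ (i div dim_row B, j div dim_col B) * B $$ (i mod dim_row B, j mod dim_col B))"

definition M1_mat :: "nat \<Rightarrow> int mat" where
  "M1_mat b = mat b b (\<lambda>(i, j). if i = j then 1 else if i = j + 1 then -1 else 0)"

definition S1_mat :: "nat \<Rightarrow> int mat" where
  "S1_mat b = mat b b (\<lambda>(i, j). if j \<le> i then 1 else 0)"

(* The families are only meant for N \<ge> 1; the value at N = 0 is the 1 x 1 identity,
   the unit of the Kronecker product. *)

fun M_mat :: "nat \<Rightarrow> nat \<Rightarrow> int mat" where
  "M_mat b 0 = 1\<^sub>m 1"
| "M_mat b (Suc 0) = M1_mat b"
| "M_mat b (Suc (Suc N)) = kronecker_mat (M1_mat b) (M_mat b (Suc N))"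

fun S_mat :: "nat \<Rightarrow> nat \<Rightarrow> int mat" where
  "S_mat b 0 = 1\<^sub>m 1"
| "S_mat b (Suc 0) = S1_mat b"
| "S_mat b (Suc (Suc N)) = kronecker_mat (S1_mat b) (S_mat b (Suc N))"

definition T_mat :: "nat \<Rightarrow> nat \<Rightarrow> int mat" where
  "T_mat b N = transpose_mat (M_mat b N)"

definition U_mat :: "nat \<Rightarrow> nat \<Rightarrow> int mat" where
  "U_mat b N = S_mat b N * T_mat b N"

definition V_mat :: "nat \<Rightarrow> nat \<Rightarrow> int mat" where
  "V_mat b N = T_mat b N * S_mat b N"

end

theory Submission
  imports Defs
begin

text \<open>
  The matrix \<open>U\<^sub>1\<close> sends a vector \<open>f\<close>, extended by \<open>f(b) = 0\<close>, to \<open>i \<mapsto> f(0) - f(i+1)\<close>. Hence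
  \<open>-U\<^sub>1\<close> is the cyclic shift on functions on \<open>\<int>/(b+1)\<close> modulo constants, each class being
  represented by the function vanishing at \<open>b\<close>; its order divides \<open>b+1\<close>. The matrix
  \<open>V\<^sub>1 = S\<^sub>1\<^sup>-\<^sup>1 U\<^sub>1 S\<^sub>1\<close> is conjugate to \<open>U\<^sub>1\<close>, and the mixed-product rule for Kronecker products
  reduces the general case to \<open>N = 1\<close>.
\<close>

section \<open>Kronecker products\<close>

lemma dim_kronecker_mat [simp]:
  "dim_row (kronecker_mat A B) = dim_row A * dim_row B"
  "dim_col (kronecker_mat A B) = dim_col A * dim_col B"
  by (simp_all add: kronecker_mat_def)

lemma kronecker_mat_carrier [simp, intro]:
  "A \<in> carrier_mat m n \<Longrightarrow> B \<in> carrier_mat p q \<Longrightarrow> kronecker_mat A B \<in> carrier_mat (m * p) (n * q)"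
  by (auto simp: kronecker_mat_def)

lemma div_mod_less_mult:
  fixes i m n :: nat
  assumes "i < m * n"
  shows "i div n < m" "i mod n < n"
  using assms by (auto simp: less_mult_imp_div_less intro!: mod_less_divisor gr0I)

text \<open>Division with remainder by \<open>n\<close> identifies the indices below
  \<open>m * n\<close> with pairs, so a summand that separates in quotient and remainder sums to a
  product.\<close>

lemma sum_div_mod:
  fixes f g :: "nat \<Rightarrow> 'a :: semiring_0"
  shows "(\<Sum>k<m * n. f (k div n) * g (k mod n)) = (\<Sum>k<m. f k) * (\<Sum>k<n. g k)"
proof -
  have "(\<Sum>k<m * n. f (k div n) * g (k mod n)) = (\<Sum>(x, y)\<in>{..<m} \<times> {..<n}. f x * g y)"
  proof (rule sum.reindex_bij_witness[of _ "\<lambda>(x, y). x * n + y" "\<lambda>k. (k div n, k mod n)"])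
    fix p assume "p \<in> {..<m} \<times> {..<n}"
    then obtain x y where p: "p = (x, y)" "x < m" "y < n" by auto
    have "x * n + y < Suc x * n" using p by simp
    also have "\<dots> \<le> m * n" using p by (intro mult_le_mono1) simp
    finally show "(case p of (x, y) \<Rightarrow> x * n + y) \<in> {..<m * n}" using p by simp
  qed (auto simp: div_mod_less_mult)
  also have "\<dots> = (\<Sum>k<m. f k) * (\<Sum>k<n. g k)"
    by (simp add: sum_product sum.cartesian_product)
  finally show ?thesis .
qed

text \<open>The mixed-product rule. Once commutativity groups the \<open>A\<close>, \<open>C\<close>
  factors and the \<open>B\<close>, \<open>D\<close> factors, the summation index enters the first
  group only through its quotient and the second only through its remainder, so
  \<open>sum_div_mod\<close> applies.\<close>

lemma kronecker_mat_mult: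
  fixes A B C D :: "'a :: comm_semiring_0 mat"
  assumes A: "A \<in> carrier_mat m n" and B: "B \<in> carrier_mat p q"
    and C: "C \<in> carrier_mat n r" and D: "D \<in> carrier_mat q s"
  shows "kronecker_mat A B * kronecker_mat C D = kronecker_mat (A * C) (B * D)"
proof (rule eq_matI)
  fix i j assume "i < dim_row (kronecker_mat (A * C) (B * D))"
    and "j < dim_col (kronecker_mat (A * C) (B * D))"
  then have ij: "i < m * p" "j < r * s" using assms by auto
  have "(kronecker_mat A B * kronecker_mat C D) $$ (i, j) =
    (\<Sum>k<n * q. (A $$ (i div p, k div q) * C $$ (k div q, j div s)) *
               (B $$ (i mod p, k mod q) * D $$ (k mod q, j mod s)))"
    using ij assms
    by (auto simp: scalar_prod_def kronecker_mat_def lessThan_atLeast0 ac_simps intro!: sum.cong)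
  also have "\<dots> = (\<Sum>k<n. A $$ (i div p, k) * C $$ (k, j div s)) *
      (\<Sum>k<q. B $$ (i mod p, k) * D $$ (k, j mod s))"
    by (rule sum_div_mod)
  also have "\<dots> = kronecker_mat (A * C) (B * D) $$ (i, j)"
    using ij assms div_mod_less_mult[OF ij(1)] div_mod_less_mult[OF ij(2)]
    by (simp add: kronecker_mat_def scalar_prod_def lessThan_atLeast0)
  finally show "(kronecker_mat A B * kronecker_mat C D) $$ (i, j) =
    kronecker_mat (A * C) (B * D) $$ (i, j)" .
qed (use assms in auto)

lemma kronecker_mat_transpose:
  "transpose_mat (kronecker_mat A B) = kronecker_mat (transpose_mat A) (transpose_mat B)"
  by (rule eq_matI) (auto simp: kronecker_mat_def div_mod_less_mult)

lemma kronecker_mat_one: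
  "kronecker_mat (1\<^sub>m m) (1\<^sub>m n) = (1\<^sub>m (m * n) :: 'a :: semiring_1 mat)"
proof (rule eq_matI)
  fix i j assume "i < dim_row (1\<^sub>m (m * n) :: 'a mat)" "j < dim_col (1\<^sub>m (m * n) :: 'a mat)"
  then have ij: "i < m * n" "j < m * n" by auto
  have "i = j \<longleftrightarrow> i div n = j div n \<and> i mod n = j mod n"
    by (metis div_mult_mod_eq)
  with ij show "kronecker_mat (1\<^sub>m m) (1\<^sub>m n) $$ (i, j) = (1\<^sub>m (m * n) :: 'a mat) $$ (i, j)"
    by (simp add: kronecker_mat_def div_mod_less_mult)
qed auto

lemma kronecker_mat_smult:
  fixes A B :: "'a :: comm_semiring_0 mat"
  shows "kronecker_mat (c \<cdot>\<^sub>m A) (d \<cdot>\<^sub>m B) = (c * d) \<cdot>\<^sub>m kronecker_mat A B"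
  by (rule eq_matI) (auto simp: kronecker_mat_def div_mod_less_mult ac_simps)

lemma kronecker_mat_pow:
  fixes A B :: "'a :: comm_semiring_1 mat"
  assumes "A \<in> carrier_mat m m" and "B \<in> carrier_mat n n"
  shows "kronecker_mat A B ^\<^sub>m k = kronecker_mat (A ^\<^sub>m k) (B ^\<^sub>m k)"
proof (induction k)
  case 0
  then show ?case using assms by (simp add: kronecker_mat_one)
next
  case (Suc k)
  then show ?case
    using kronecker_mat_mult[of "A ^\<^sub>m k" m m "B ^\<^sub>m k" n n A m B n] assms by simp
qed

section \<open>The case \<open>N = 1\<close>\<close>

text \<open>\<open>^\<^sub>m\<close> adds each new factor on the right. The entry formula below
  peels factors off on the left, where the sparse rows of the base matrix can be used.\<close>

lemma pow_mat_Suc_left: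
  fixes A :: "'a :: semiring_1 mat"
  assumes A: "A \<in> carrier_mat n n"
  shows "A ^\<^sub>m Suc k = A * A ^\<^sub>m k"
proof (induction k)
  case 0
  then show ?case using A by simp
next
  case (Suc k)
  have "A ^\<^sub>m Suc (Suc k) = (A * A ^\<^sub>m k) * A" using Suc by simp
  also have "\<dots> = A * (A ^\<^sub>m k * A)" using A by (intro assoc_mult_mat) auto
  finally show ?case by simp
qed

lemma M1_mat_carrier [simp]: "M1_mat b \<in> carrier_mat b b"
  and S1_mat_carrier [simp]: "S1_mat b \<in> carrier_mat b b"
  by (simp_all add: M1_mat_def S1_mat_def)

text \<open>Taking differences undoes taking partial sums.\<close>

lemma M1_mat_mult_S1_mat: "M1_mat b * S1_mat b = 1\<^sub>m b"
proof (rule eq_matI)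
  fix i j assume "i < dim_row (1\<^sub>m b :: int mat)" "j < dim_col (1\<^sub>m b :: int mat)"
  then have ij: "i < b" "j < b" by auto
  have "(M1_mat b * S1_mat b) $$ (i, j) = (\<Sum>k<b. M1_mat b $$ (i, k) * S1_mat b $$ (k, j))"
    using ij by (simp add: M1_mat_def S1_mat_def scalar_prod_def lessThan_atLeast0)
  \<comment> \<open>The guard \<open>i \<noteq> 0\<close> keeps truncated subtraction from placing a
    spurious -1 in row 0.\<close>
  also have "\<dots> = (\<Sum>k<b. (if k = i then if j \<le> i then 1 else 0 else 0)
            - (if i \<noteq> 0 \<and> k = i - 1 then if j \<le> i - 1 then 1 else 0 else 0))"
    using ij by (intro sum.cong) (auto simp: M1_mat_def S1_mat_def)
  also have "\<dots> = 1\<^sub>m b $$ (i, j)"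
    using ij by (cases i) (auto simp: sum_subtractf)
  finally show "(M1_mat b * S1_mat b) $$ (i, j) = 1\<^sub>m b $$ (i, j)" .
qed (auto simp: M1_mat_def S1_mat_def)

text \<open>The sum collapses to [j <= i] - [j - 1 <= i] for j > 0, which is nonzero only at j = i +
  1. Column 0 lacks the second term and is constantly 1. In the last row the -1 would fall in column
  \<open>b\<close>, outside the matrix.\<close>

lemma S1_mat_mult_transpose_M1_mat:
  "S1_mat b * transpose_mat (M1_mat b) =
   mat b b (\<lambda>(i, j). (if j = 0 then 1 else 0) - (if j = i + 1 then 1 else 0))"
proof (rule eq_matI, goal_cases)
  case (1 i j)
  then have ij: "i < b" "j < b" by auto
  have "(S1_mat b * transpose_mat (M1_mat b)) $$ (i, j) =
      (\<Sum>k<b. S1_mat b $$ (i, k) * M1_mat b $$ (j, k))"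
    using ij by (simp add: M1_mat_def S1_mat_def scalar_prod_def lessThan_atLeast0)
  also have "\<dots> = (\<Sum>k<b. (if k = j then if j \<le> i then 1 else 0 else 0)
            - (if j \<noteq> 0 \<and> k = j - 1 then if j - 1 \<le> i then 1 else 0 else 0))"
    using ij by (intro sum.cong) (auto simp: M1_mat_def S1_mat_def)
  also have "\<dots> = (if j = 0 then 1 else 0) - (if j = i + 1 then 1 else 0)"
    using ij by (cases j) (auto simp: sum_subtractf)
  finally show ?case using ij by simp
qed (auto simp: M1_mat_def S1_mat_def)

text \<open>The \<open>k\<close>-fold shift sends f to f(i + k) - f(b + k), up to sign and with
  arguments modulo b + 1. The subtracted constant restores the value 0 at \<open>b\<close>. The
  entry is the case where f is the indicator of \<open>j\<close>.\<close>

lemma U1_mat_pow_entry: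
  assumes "i < b" "j < b"
  shows "((S1_mat b * transpose_mat (M1_mat b)) ^\<^sub>m k) $$ (i, j) =
    (-1) ^ k * ((if (i + k) mod (b + 1) = j then 1 else 0) -
                (if (b + k) mod (b + 1) = j then 1 else 0))"
  using assms
proof (induction k arbitrary: i)
  case 0
  then show ?case by (auto simp: M1_mat_def S1_mat_def)
next
  case (Suc k)
  define U where "U = S1_mat b * transpose_mat (M1_mat b)"
  have U: "U \<in> carrier_mat b b"
    unfolding U_def by (rule mult_carrier_mat[of _ b b]) simp_all
  have Uk: "U ^\<^sub>m k \<in> carrier_mat b b" using U by simp
  let ?a = "\<lambda>i. (-1) ^ k * ((if (i + k) mod (b + 1) = j then 1 else 0) -
                (if (b + k) mod (b + 1) = j then 1 else 0)) :: int"
  have "(U ^\<^sub>m Suc k) $$ (i, j) = (\<Sum>l<b. U $$ (i, l) * (U ^\<^sub>m k) $$ (l, j))"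
    using Suc.prems U Uk by (simp only: pow_mat_Suc_left[OF U])
      (simp add: scalar_prod_def lessThan_atLeast0)
  also have "\<dots> = (\<Sum>l<b. (if l = 0 then ?a 0 else 0) - (if l = i + 1 then ?a (i + 1) else 0))"
    using Suc by (intro sum.cong) (auto simp: U_def S1_mat_mult_transpose_M1_mat)
  also have "\<dots> = ?a 0 - (if i + 1 < b then ?a (i + 1) else 0)"
    using Suc.prems by (simp only: sum_subtractf sum.delta) auto
  \<comment> \<open>The closed form also makes sense in the virtual row \<open>b\<close>, where its
    two indicators cancel. This removes the case distinction at the last row.\<close>
  also have "\<dots> = ?a 0 - ?a (i + 1)"
  proof (cases "i + 1 < b")
    case False
    then have "i + 1 = b" using Suc.prems by simp
    then show ?thesis by simp
  qed simp
  \<comment> \<open>The normalising terms at b + k are the same in both rows and cancel.\<close>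
  also have "\<dots> = (-1) ^ Suc k * ((if (i + Suc k) mod (b + 1) = j then 1 else 0) -
      (if k mod (b + 1) = j then 1 else 0))"
    by (simp add: algebra_simps)
  also have "k mod (b + 1) = (b + Suc k) mod (b + 1)"
    using mod_add_self1[of "b + 1" k] by (simp add: ac_simps)
  finally show ?case by (simp add: U_def)
qed

lemma U1_mat_pow:
  "(S1_mat b * transpose_mat (M1_mat b)) ^\<^sub>m (b + 1) = (-1) ^ (b + 1) \<cdot>\<^sub>m 1\<^sub>m b"
proof (rule eq_matI, goal_cases)
  case (1 i j)
  then have ij: "i < b" "j < b" by auto
  \<comment> \<open>After a full turn the shift is trivial, and the normalising indicator tests b =
    j, which fails since \<open>j < b\<close>.\<close>
  have "(i + (b + 1)) mod (b + 1) = i" "(b + (b + 1)) mod (b + 1) = b"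
    using ij by (simp_all only: mod_add_self2) auto
  then show ?case
    using ij by (simp only: U1_mat_pow_entry) simp
qed (auto simp: M1_mat_def S1_mat_def pow_mat_dim_square)

lemma V1_mat_pow:
  "(transpose_mat (M1_mat b) * S1_mat b) ^\<^sub>m (b + 1) = (-1) ^ (b + 1) \<cdot>\<^sub>m 1\<^sub>m b"
proof -
  let ?M = "M1_mat b" and ?S = "S1_mat b" and ?c = "(-1) ^ (b + 1) :: int"
  define T where "T = transpose_mat ?M"
  have T: "T \<in> carrier_mat b b" by (simp add: T_def)
  note cs = T M1_mat_carrier[of b] S1_mat_carrier[of b]
  have U: "?S * T \<in> carrier_mat b b" and V: "T * ?S \<in> carrier_mat b b"
    using cs by (auto intro!: mult_carrier_mat[of _ b b])
  \<comment> \<open>\<open>?S\<close> intertwines the two products. Since \<open>?M\<close> is a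
    left inverse of \<open>?S\<close>, multiplying by it on the left then isolates the power of
    \<open>T * ?S\<close>.\<close>
  have conj: "?S * (T * ?S) ^\<^sub>m k = (?S * T) ^\<^sub>m k * ?S" for k
  proof (induction k)
    case 0
    then show ?case using T
      by (simp add: right_mult_one_mat[OF S1_mat_carrier] left_mult_one_mat[OF S1_mat_carrier])
  next
    case (Suc k)
    have "?S * (T * ?S) ^\<^sub>m Suc k = (?S * (T * ?S) ^\<^sub>m k) * (T * ?S)"
      using assoc_mult_mat[of ?S b b "(T * ?S) ^\<^sub>m k" b "T * ?S" b] cs V by simp
    also have "\<dots> = (?S * T) ^\<^sub>m k * (?S * (T * ?S))"
      unfolding Suc using cs U V by (intro assoc_mult_mat) auto
    also have "?S * (T * ?S) = (?S * T) * ?S"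
      using cs by (intro assoc_mult_mat[of _ b b _ b _ b, symmetric]) auto
    also have "(?S * T) ^\<^sub>m k * (\<dots>) = (?S * T) ^\<^sub>m Suc k * ?S"
      using cs U assoc_mult_mat[of "(?S * T) ^\<^sub>m k" b b "?S * T" b ?S b] by simp
    finally show ?case .
  qed
  have Vk: "(T * ?S) ^\<^sub>m (b + 1) \<in> carrier_mat b b" using V by (rule pow_carrier_mat)
  have "(T * ?S) ^\<^sub>m (b + 1) = (?M * ?S) * (T * ?S) ^\<^sub>m (b + 1)"
    using Vk by (simp only: M1_mat_mult_S1_mat left_mult_one_mat)
  also have "\<dots> = ?M * (?S * (T * ?S) ^\<^sub>m (b + 1))"
    using cs Vk by (intro assoc_mult_mat)
  also have "\<dots> = ?M * ((?c \<cdot>\<^sub>m 1\<^sub>m b) * ?S)"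
    unfolding conj unfolding T_def U1_mat_pow ..
  also have "(?c \<cdot>\<^sub>m 1\<^sub>m b) * ?S = ?c \<cdot>\<^sub>m ?S"
    using cs by (subst mult_smult_assoc_mat[of _ b b _ b])
      (simp_all add: left_mult_one_mat[OF S1_mat_carrier])
  also have "?M * (?c \<cdot>\<^sub>m ?S) = ?c \<cdot>\<^sub>m 1\<^sub>m b"
    using cs by (subst mult_smult_distrib[of _ b b _ b]) (simp_all add: M1_mat_mult_S1_mat)
  finally show ?thesis by (simp only: T_def)
qed

section \<open>The general case\<close>

text \<open>With the 1 x 1 identity as value at 0, one recursion covers every \<open>N\<close>, so
  the inductions below can start at 0.\<close>

lemma M_mat_Suc: "M_mat b (Suc N) = kronecker_mat (M1_mat b) (M_mat b N)"
  by (cases N) (auto simp: kronecker_mat_def M1_mat_def intro!: eq_matI)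

lemma S_mat_Suc: "S_mat b (Suc N) = kronecker_mat (S1_mat b) (S_mat b N)"
  by (cases N) (auto simp: kronecker_mat_def S1_mat_def intro!: eq_matI)

lemma M_mat_carrier [simp]: "M_mat b N \<in> carrier_mat (b ^ N) (b ^ N)"
  by (induction N) (auto simp: M_mat_Suc simp del: M_mat.simps(2,3))

lemma S_mat_carrier [simp]: "S_mat b N \<in> carrier_mat (b ^ N) (b ^ N)"
  by (induction N) (auto simp: S_mat_Suc simp del: S_mat.simps(2,3))

lemma T_mat_carrier [simp]: "T_mat b N \<in> carrier_mat (b ^ N) (b ^ N)"
  by (simp add: T_mat_def)

lemma U_mat_carrier [simp]: "U_mat b N \<in> carrier_mat (b ^ N) (b ^ N)"
  and V_mat_carrier [simp]: "V_mat b N \<in> carrier_mat (b ^ N) (b ^ N)"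
  unfolding U_mat_def V_mat_def by (auto intro!: mult_carrier_mat[of _ "b ^ N" "b ^ N"])

lemma T_mat_Suc: "T_mat b (Suc N) = kronecker_mat (transpose_mat (M1_mat b)) (T_mat b N)"
  by (simp add: T_mat_def M_mat_Suc kronecker_mat_transpose)

lemma U_mat_Suc:
  "U_mat b (Suc N) = kronecker_mat (S1_mat b * transpose_mat (M1_mat b)) (U_mat b N)"
  unfolding U_mat_def S_mat_Suc T_mat_Suc by (rule kronecker_mat_mult[of _ b b _ "b ^ N" "b ^ N" _ b _ "b ^ N"]) simp_all

lemma V_mat_Suc:
  "V_mat b (Suc N) = kronecker_mat (transpose_mat (M1_mat b) * S1_mat b) (V_mat b N)"
  unfolding V_mat_def S_mat_Suc T_mat_Suc by (rule kronecker_mat_mult[of _ b b _ "b ^ N" "b ^ N" _ b _ "b ^ N"]) simp_all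

text \<open>Stated for an abstract family so that it serves both U and V. Powers act factorwise on
  Kronecker products, and each factor \<open>A\<close> contributes one scalar
  \<open>c\<close>.\<close>

lemma kronecker_pow_scalar:
  fixes W :: "nat \<Rightarrow> 'a :: comm_semiring_1 mat"
  assumes W0: "W 0 = 1\<^sub>m 1" and W_Suc: "\<And>N. W (Suc N) = kronecker_mat A (W N)"
    and W: "\<And>N. W N \<in> carrier_mat (b ^ N) (b ^ N)"
    and A: "A \<in> carrier_mat b b" and pow: "A ^\<^sub>m k = c \<cdot>\<^sub>m 1\<^sub>m b"
  shows "W N ^\<^sub>m k = c ^ N \<cdot>\<^sub>m 1\<^sub>m (b ^ N)"
proof (induction N)
  case 0
  have "(1\<^sub>m 1 :: 'a mat) ^\<^sub>m k = 1\<^sub>m 1" by (induction k) simp_all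
  moreover have "1 \<cdot>\<^sub>m 1\<^sub>m 1 = (1\<^sub>m 1 :: 'a mat)" by (rule eq_matI) auto
  ultimately show ?case using W0 by simp
next
  case (Suc N)
  then show ?case
    by (simp add: W_Suc kronecker_mat_pow[OF A W] pow kronecker_mat_smult kronecker_mat_one)
qed

theorem theorem4p3:
  fixes b N :: nat
  assumes "b \<ge> 2" and "N \<ge> 1"
  shows "U_mat b N ^\<^sub>m (b + 1) = (-1) ^ (N * (b + 1)) \<cdot>\<^sub>m 1\<^sub>m (b ^ N)
       \<and> V_mat b N ^\<^sub>m (b + 1) = (-1) ^ (N * (b + 1)) \<cdot>\<^sub>m 1\<^sub>m (b ^ N)"
proof -
  have exponent: "(-1) ^ (N * (b + 1)) = ((-1) ^ (b + 1) :: int) ^ N"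
    by (simp only: power_mult[symmetric] mult.commute)
  have *: "S1_mat b * transpose_mat (M1_mat b) \<in> carrier_mat b b"
    "transpose_mat (M1_mat b) * S1_mat b \<in> carrier_mat b b"
    by (auto intro!: mult_carrier_mat[of _ b b])
  have "U_mat b 0 = 1\<^sub>m 1" "V_mat b 0 = 1\<^sub>m 1"
    by (simp_all add: U_mat_def V_mat_def T_mat_def)
  then show ?thesis
    unfolding exponent
    using kronecker_pow_scalar[of "U_mat b", OF _ U_mat_Suc U_mat_carrier *(1) U1_mat_pow]
      kronecker_pow_scalar[of "V_mat b", OF _ V_mat_Suc V_mat_carrier *(2) V1_mat_pow]
    by blast
qed

end
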